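(* Let $\mathcal{H}$ and $\mathcal{G}$ be real Hilbert spaces, let $A\colon\mathcal{H}\to2^{\mathcal{H}}$ and $B\colon\mathcal{G}\to2^{\mathcal{G}}$ be maximally monotone operators, and let $L\colon\mathcal{H}\to\mathcal{G}$ be a non-zero linear bounded operator. Assume that $\boldsymbol{Z}=\{(\hat x,\hat u)\in\mathcal{H}\times\mathcal{G}: 0\in A\hat x+L^*\hat u,\ 0\in B^{-1}\hat u-L\hat x\}$ is non-empty. Assume that $\mathrm{ran}\,L=\mathcal{G}$, let $\Upsilon\colon\mathcal{H}\to\mathcal{H}$ be a strongly monotone self-adjoint linear operator, and set $\Sigma=(L\Upsilon L^* )^{-1}$. Let $(x_0,u_0)\in\mathcal{H}\times\mathcal{G}$ and consider the Split-Douglas-Rachford recurrence: for every $n\in\mathbb{N}$, $$\begin{aligned} v_n&=\Sigma(\mathrm{Id}-J_{\Sigma^{-1}B})(Lx_n+\Sigma^{-1}u_n),\\ z_n&=x_n-\Upsilon L^*v_n,\\ x_{n+1}&=J_{\Upsilon A}z_n,\\ u_{n+1}&=\Sigma L(x_{n+1}-x_n)+v_n.\end{aligned}$$ Then this algorithm reduces to the recurrence $$(\forall n\in\mathbb{N})\quad z_{n+1}=J_{\Upsilon L^*BL}\big(2J_{\Upsilon A}z_n-z_n\big)+z_n-J_{\Upsilon A}z_n,$$ i.e., the sequence $(z_n)_{n\in\mathbb{N}}$ it generates satisfies this recurrence, where $z_0=x_0-\Upsilon L^*\Sigma(\mathrm{Id}-J_{\Sigma^{-1}B})(Lx_0+\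Sigma^{-1}u_0)$.
   Context: A linear self-adjoint operator $\Upsilon$ is strongly monotone if there is $\beta>0$ with $\langle x\mid\Upsilon x\rangle\ge\beta\|x\|^2$ for all $x$. For a set-valued operator $M$, $M^{-1}u=\{x:u\in Mx\}$ and the resolvent is $J_M=(\mathrm{Id}+M)^{-1}$; thus $J_{\Upsilon A}=(\mathrm{Id}+\Upsilon A)^{-1}$, $J_{\Sigma^{-1}B}=(\mathrm{Id}+\Sigma^{-1}B)^{-1}$ and $J_{\Upsilon L^*BL}=(\mathrm{Id}+\Upsilon L^*BL)^{-1}$. $L^*$ is the adjoint of $L$ and $\mathrm{ran}\,L$ its range. When $\mathrm{ran}\,L=\mathcal{G}$ the operator $L\Upsilon L^*$ is strongly monotone, hence invertible, so $\Sigma$ is well defined. *)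

theory Defs
  imports "HOL-Analysis.Analysis"
begin

text \<open>
  A set-valued operator from \<open>'a\<close> to \<open>'b\<close> is a function \<open>'a \<Rightarrow> 'b set\<close>. Its composition with
  single-valued operators \<open>F\<close> (on the left) and \<open>K\<close> (on the right) is \<open>\<lambda>x. F ` M (K x)\<close>.
\<close>

definition op_inverse :: "('a \<Rightarrow> 'b set) \<Rightarrow> 'b \<Rightarrow> 'a set" where
  "op_inverse M u = {x. u \<in> M x}"

definition monotone_operator :: "('a::real_inner \<Rightarrow> 'a set) \<Rightarrow> bool" where
  "monotone_operator M \<longleftrightarrow>
     (\<forall>x y. \<forall>u\<in>M x. \<forall>v\<in>M y. 0 \<le> (x - y) \<bullet> (u - v))"

text \<open>The order on \<open>'a \<Rightarrow> 'a set\<close> is pointwise inclusion, i.e. inclusion of graphs.\<close>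

definition maximally_monotone :: "('a::real_inner \<Rightarrow> 'a set) \<Rightarrow> bool" where
  "maximally_monotone M \<longleftrightarrow>
     monotone_operator M \<and> (\<forall>N. monotone_operator N \<longrightarrow> M \<le> N \<longrightarrow> N = M)"

definition resolvent :: "('a::real_inner \<Rightarrow> 'a set) \<Rightarrow> 'a \<Rightarrow> 'a set" where
  "resolvent M = op_inverse (\<lambda>x. (\<lambda>y. x + y) ` M x)"

text \<open>
  The resolvent read as a point-valued map. It is the resolvent wherever the latter is a
  singleton, and unspecified elsewhere. The operators to which it is applied below are maximally
  monotone with respect to an equivalent inner product on the space, so by Minty's theorem their
  resolvents are singletons everywhere.
\<close>

definition J :: "('a::real_inner \<Rightarrow> 'a set) \<Rightarrow> 'a \<Rightarrow> 'a" where
  "J M z = the_elem (resolvent M z)"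

definition self_adjoint :: "('a::real_inner \<Rightarrow> 'a) \<Rightarrow> bool" where
  "self_adjoint T \<longleftrightarrow> (\<forall>x y. T x \<bullet> y = x \<bullet> T y)"

definition strongly_monotone :: "('a::real_inner \<Rightarrow> 'a) \<Rightarrow> bool" where
  "strongly_monotone T \<longleftrightarrow> (\<exists>\<beta>>0. \<forall>x. \<beta> * (norm x)\<^sup>2 \<le> x \<bullet> T x)"

definition primal_dual_solutions ::
  "('a::real_inner \<Rightarrow> 'a set) \<Rightarrow> ('b::real_inner \<Rightarrow> 'b set) \<Rightarrow> ('a \<Rightarrow> 'b) \<Rightarrow> ('a \<times> 'b) set" where
  "primal_dual_solutions A B L =
     {(x, u). 0 \<in> (\<lambda>a. a + adjoint L u) ` A x \<and> 0 \<in> (\<lambda>b. b - L x) ` op_inverse B u}"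

end

theory Submission
  imports Defs
begin

text \<open>
  Put \<open>S = L \<circ> \<Upsilon> \<circ> adjoint L\<close>, the inverse of \<open>\<Sigma>\<close>. Since the resolvent of
  \<open>S B\<close> is everywhere defined, \<open>v n\<close> belongs to \<open>B\<close> at the point
  \<open>L (x n) + S (u n) - S (v n)\<close>. The updates of \<open>z\<close> and \<open>u\<close> turn this point, at index \<open>n + 1\<close>,
  into \<open>L q\<close> for \<open>q = 2 x (n + 1) - z n - \<Upsilon> (adjoint L (v (n + 1)))\<close>, so \<open>q\<close> is the resolvent
  of \<open>\<Upsilon> L\<^sup>* B L\<close> at \<open>2 x (n + 1) - z n\<close>. The analytic content is the invertibility of \<open>S\<close> and
  the existence of the resolvent of \<open>S B\<close>, that is, Minty's theorem in the metric of \<open>\<Sigma>\<close>.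
\<close>

section \<open>Bounded and positive operators on Hilbert spaces\<close>

text \<open>Baire category: the closed sets \<open>F k\<close> cover the space, so one of them
  contains a ball, and moving from its centre in the direction of \<open>u\<close> bounds
  \<open>norm u\<close>.\<close>

lemma uniform_boundedness_inner:
  fixes U :: "'a::{real_inner, banach} set"
  assumes ptw: "\<And>y. \<exists>C. \<forall>u\<in>U. \<bar>u \<bullet> y\<bar> \<le> C"
  shows "\<exists>C. \<forall>u\<in>U. norm u \<le> C"
proof -
  define F where "F k = {y. \<forall>u\<in>U. \<bar>u \<bullet> y\<bar> \<le> real k}" for k :: nat
  have closed_F: "closed (F k)" for k
  proof -
    have "F k = (\<Inter>u\<in>U. {y. \<bar>u \<bullet> y\<bar> \<le> real k})"
      by (auto simp: F_def)
    then show ?thesis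
      by (auto intro!: closed_INT closed_Collect_le continuous_intros)
  qed
  have cover: "\<Union> (range F) = UNIV"
  proof -
    have "\<exists>k. y \<in> F k" for y
    proof -
      obtain C where C: "\<forall>u\<in>U. \<bar>u \<bullet> y\<bar> \<le> C"
        using ptw by blast
      obtain k :: nat where "C \<le> real k"
        using real_arch_simple by blast
      with C have "y \<in> F k"
        by (fastforce simp: F_def)
      then show ?thesis ..
    qed
    then show ?thesis by blast
  qed
  have "\<exists>k. interior (F k) \<noteq> {}"
  proof (rule ccontr)
    assume "\<not> ?thesis"
    moreover have "Met_TC.mcomplete TYPE('a)"
      by (simp add: complete_UNIV)
    ultimately have "euclidean interior_of (\<Union> (range F)) = {}"
      using Met_TC.metric_Baire_category_alt[of "range F"] closed_F by auto
    then show False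
      using cover by simp
  qed
  then obtain k y\<^sub>0 where "y\<^sub>0 \<in> interior (F k)" by blast
  then obtain r where r: "r > 0" "ball y\<^sub>0 r \<subseteq> F k"
    by (auto simp: mem_interior)
  have "norm u \<le> 4 * real k / r" if u: "u \<in> U" for u
  proof (cases "u = 0")
    case True
    then show ?thesis using r by simp
  next
    case False
    \<comment> \<open>Length \<open>r / 2\<close> keeps \<open>y\<^sub>0 + y\<close> in the ball.
      Subtracting the bounds at the two points costs \<open>2 * real k\<close>, and dividing by
      \<open>r / 2\<close> gives the constant.\<close>
    define y where "y = (r / (2 * norm u)) *\<^sub>R u"
    have "norm y < r"
      using r False by (simp add: y_def)
    then have "y\<^sub>0 + y \<in> F k"
      using r by (auto simp: dist_norm)
    moreover have "y\<^sub>0 \<in> F k"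
      using r by auto
    ultimately have "\<bar>u \<bullet> (y\<^sub>0 + y)\<bar> \<le> real k" "\<bar>u \<bullet> y\<^sub>0\<bar> \<le> real k"
      using u by (auto simp: F_def)
    then have "u \<bullet> y \<le> 2 * real k"
      by (simp add: inner_add_right)
    moreover have "u \<bullet> y = r / 2 * norm u"
      using False by (simp add: y_def dot_square_norm power2_eq_square)
    ultimately show ?thesis
      using r by (simp add: field_simps)
  qed
  then show ?thesis by blast
qed

text \<open>Self-adjointness moves \<open>K\<close> onto the test vector, so the image of the unit
  ball is pointwise bounded by \<open>norm (K y)\<close>. This supplies the continuity of operators
  known only to be linear, such as \<open>\<Upsilon>\<close>.\<close>

lemma Hellinger_Toeplitz:
  fixes K :: "'a::{real_inner, banach} \<Rightarrow> 'a"
  assumes "linear K" and "self_adjoint K"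
  shows "bounded_linear K"
proof -
  have "\<exists>C. \<forall>u\<in>K ` cball 0 1. \<bar>u \<bullet> y\<bar> \<le> C" for y
  proof (intro exI ballI)
    fix u assume "u \<in> K ` cball 0 1"
    then obtain a where a: "u = K a" "norm a \<le> 1" by auto
    have "\<bar>u \<bullet> y\<bar> = \<bar>a \<bullet> K y\<bar>"
      using assms(2) a by (simp add: self_adjoint_def)
    also have "\<dots> \<le> norm a * norm (K y)"
      by (rule Cauchy_Schwarz_ineq2)
    also have "\<dots> \<le> norm (K y)"
      using a mult_right_mono[of "norm a" 1 "norm (K y)"] by simp
    finally show "\<bar>u \<bullet> y\<bar> \<le> norm (K y)" .
  qed
  then obtain C where C: "\<And>a. norm a \<le> 1 \<Longrightarrow> norm (K a) \<le> C"
    using uniform_boundedness_inner[of "K ` cball 0 1"] by fastforce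
  have "norm (K a) \<le> norm a * C" for a
  proof (cases "a = 0")
    case True
    then show ?thesis using linear_0[OF assms(1)] by simp
  next
    case False
    have "norm (K ((1 / norm a) *\<^sub>R a)) \<le> C"
      using False by (intro C) simp
    then show ?thesis
      using False by (simp add: linear_scale[OF assms(1)] field_simps)
  qed
  then show ?thesis
    using assms(1) by (intro bounded_linear_intro[where K = C])
      (simp_all add: linear_add linear_scale)
qed

section \<open>Quadratic forms of strongly monotone operators\<close>

lemma strongly_monotone_nonneg:
  assumes "strongly_monotone K"
  shows "0 \<le> a \<bullet> K a"
  using assms unfolding strongly_monotone_def
  by (meson dual_order.trans less_imp_le mult_nonneg_nonneg zero_le_power2)

lemma strongly_monotone_eq_0:
  assumes "strongly_monotone K" and "a \<bullet> K a \<le> 0"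
  shows "a = 0"
proof -
  obtain \<beta> where \<beta>: "\<beta> > 0" "\<beta> * (norm a)\<^sup>2 \<le> a \<bullet> K a"
    using assms(1) by (auto simp: strongly_monotone_def)
  then have "(norm a)\<^sup>2 \<le> 0"
    using assms(2) by (meson mult_pos_pos not_le order.trans)
  then show ?thesis by simp
qed

lemma quadratic_form_add:
  assumes "linear K" and "self_adjoint K"
  shows "(a + r *\<^sub>R d) \<bullet> K (a + r *\<^sub>R d) = a \<bullet> K a + 2 * r * (d \<bullet> K a) + r\<^sup>2 * (d \<bullet> K d)"
proof -
  have "a \<bullet> K d = d \<bullet> K a"
    using assms(2) by (metis inner_commute self_adjoint_def)
  then show ?thesis
    using assms(1)
    by (simp add: linear_add linear_scale inner_add_left inner_add_right power2_eq_square algebra_simps)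
qed

text \<open>
  For the epigraph \<open>E\<close> of a convex function, this is the existence of a minimiser of that function
  plus \<open>1/2 a \<bullet> K a\<close>, together with the first-order condition it satisfies. The inner product
  with \<open>K\<close> makes minimising sequences Cauchy by the parallelogram identity, so that neither weak
  compactness nor a finite dimension is involved.
\<close>

lemma quadratic_minimizer:
  fixes K :: "'a::{real_inner, banach} \<Rightarrow> 'a" and E :: "('a \<times> real) set"
  assumes K: "linear K" "self_adjoint K" "strongly_monotone K"
    and E: "closed E" "convex E" "E \<noteq> {}"
    and bdd: "\<And>a t. (a, t) \<in> E \<Longrightarrow> m \<le> t + (a \<bullet> K a) / 2"
  shows "\<exists>a t. (a, t) \<in> E \<and> (\<forall>(b, s)\<in>E. t + a \<bullet> K a \<le> s + b \<bullet> K a)"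
proof -
  define \<Phi> where "\<Phi> p = snd p + (fst p \<bullet> K (fst p)) / 2" for p
  define \<mu> where "\<mu> = Inf (\<Phi> ` E)"
  have bdd_below: "bdd_below (\<Phi> ` E)"
    using bdd by (intro bdd_belowI[of _ m]) (auto simp: \<Phi>_def)
  have \<mu>_le: "\<mu> \<le> \<Phi> p" if "p \<in> E" for p
    unfolding \<mu>_def using that bdd_below by (intro cInf_lower) auto
  have "\<exists>p\<in>E. \<Phi> p < \<mu> + 1 / real (Suc n)" for n
    using cInf_lessD[of "\<Phi> ` E" "\<mu> + 1 / real (Suc n)"] E(3) by (auto simp: \<mu>_def)
  then obtain p where p: "\<And>n. p n \<in> E" "\<And>n. \<Phi> (p n) < \<mu> + 1 / real (Suc n)"
    by metis
  have \<Phi>_p: "(\<lambda>n. \<Phi> (p n)) \<longlonglongrightarrow> \<mu>"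
  proof (rule tendsto_sandwich[OF _ _ tendsto_const])
    show "(\<lambda>n. \<mu> + 1 / real (Suc n)) \<longlonglongrightarrow> \<mu>"
      using tendsto_add[OF tendsto_const[of \<mu>] LIMSEQ_inverse_real_of_nat]
      by (simp add: field_simps)
    show "\<forall>\<^sub>F n in sequentially. \<mu> \<le> \<Phi> (p n)"
      using \<mu>_le[OF p(1)] by simp
    show "\<forall>\<^sub>F n in sequentially. \<Phi> (p n) \<le> \<mu> + 1 / real (Suc n)"
      using p(2) by (intro always_eventually allI less_imp_le)
  qed
  obtain \<beta> where \<beta>: "\<beta> > 0" "\<And>a. \<beta> * (norm a)\<^sup>2 \<le> a \<bullet> K a"
    using K(3) by (auto simp: strongly_monotone_def)
  \<comment> \<open>With \<open>d = fst r - fst q\<close>, half the quadratic form at the midpoint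
    falls short of the mean of its end values by exactly
    \<open>(d \<bullet> K d) / 8\<close>.\<close>
  have midpoint: "\<mu> + \<beta> / 8 * (norm (fst q - fst r))\<^sup>2 \<le> (\<Phi> q + \<Phi> r) / 2"
    if "q \<in> E" "r \<in> E" for q r
  proof -
    define d where "d = fst r - fst q"
    have r: "fst r = fst q + 1 *\<^sub>R d" by (simp add: d_def)
    have h: "(1/2) *\<^sub>R q + (1/2) *\<^sub>R r \<in> E"
      using E(2) that by (intro convexD) auto
    have "fst ((1/2) *\<^sub>R q + (1/2) *\<^sub>R r) = fst q + (1/2) *\<^sub>R d"
      by (simp add: d_def algebra_simps flip: scaleR_left_distrib)
    then have "\<Phi> ((1/2) *\<^sub>R q + (1/2) *\<^sub>R r)
        = snd q / 2 + snd r / 2 + ((fst q + (1/2) *\<^sub>R d) \<bullet> K (fst q + (1/2) *\<^sub>R d)) / 2"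
      by (simp add: \<Phi>_def)
    also have "\<dots> = (\<Phi> q + \<Phi> r) / 2 - (d \<bullet> K d) / 8"
      unfolding \<Phi>_def r quadratic_form_add[OF K(1,2)] by (simp add: power2_eq_square field_simps)
    also have "\<dots> \<le> (\<Phi> q + \<Phi> r) / 2 - \<beta> / 8 * (norm d)\<^sup>2"
      using \<beta>(2)[of d] by simp
    finally show ?thesis
      using \<mu>_le[OF h] unfolding d_def norm_minus_commute[of "fst q"] by linarith
  qed
  have "Cauchy (\<lambda>n. fst (p n))"
  proof (rule CauchyI)
    fix e :: real assume "e > 0"
    then have "\<beta> / 8 * e\<^sup>2 > 0" using \<beta> by simp
    then obtain N where N: "1 / real (Suc N) < \<beta> / 8 * e\<^sup>2"
      using nat_approx_posE by blast
    have \<Phi>_less: "\<Phi> (p n) < \<mu> + \<beta> / 8 * e\<^sup>2" if "n \<ge> N" for n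
    proof -
      have "1 / real (Suc n) \<le> 1 / real (Suc N)" using that by (intro divide_left_mono) auto
      then show ?thesis using p(2)[of n] N by simp
    qed
    have "norm (fst (p i) - fst (p j)) < e" if "i \<ge> N" "j \<ge> N" for i j
    proof -
      have "\<beta> / 8 * (norm (fst (p i) - fst (p j)))\<^sup>2 < \<beta> / 8 * e\<^sup>2"
        using midpoint[OF p(1)[of i] p(1)[of j]] \<Phi>_less[OF that(1)] \<Phi>_less[OF that(2)]
        by (simp add: field_simps)
      then have "(norm (fst (p i) - fst (p j)))\<^sup>2 < e\<^sup>2" using \<beta>(1) by simp
      then show ?thesis
        using \<open>e > 0\<close> power_less_imp_less_base[of _ 2 e] by simp
    qed
    then show "\<exists>M. \<forall>i\<ge>M. \<forall>j\<ge>M. norm (fst (p i) - fst (p j)) < e" by blast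
  qed
  then obtain a where a: "(\<lambda>n. fst (p n)) \<longlonglongrightarrow> a"
    using Cauchy_convergent convergent_def by blast
  have Ka: "(\<lambda>n. K (fst (p n))) \<longlonglongrightarrow> K a"
    using bounded_linear.tendsto[OF Hellinger_Toeplitz[OF K(1,2)] a] .
  \<comment> \<open>The only value with \<open>\<Phi> (a, t) = \<mu>\<close>; the heights
    \<open>snd (p n)\<close> converge to it.\<close>
  define t where "t = \<mu> - (a \<bullet> K a) / 2"
  have "(\<lambda>n. \<Phi> (p n) - (fst (p n) \<bullet> K (fst (p n))) / 2) \<longlonglongrightarrow> t"
    unfolding t_def by (intro tendsto_intros \<Phi>_p a Ka) simp
  then have "(\<lambda>n. snd (p n)) \<longlonglongrightarrow> t"
    by (simp add: \<Phi>_def)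
  from tendsto_Pair[OF a this] have aE: "(a, t) \<in> E"
    using closed_sequentially[OF E(1), of p] p(1) by simp
  have "t + a \<bullet> K a \<le> s + b \<bullet> K a" if bE: "(b, s) \<in> E" for b s
  proof -
    \<comment> \<open>\<open>c\<close> is the derivative of \<open>\<Phi>\<close> at
      \<open>(a, t)\<close> towards \<open>(b, s)\<close> and \<open>k\<close> the second-order
      coefficient. Minimality along the segment gives \<open>0 \<le> r * (c + r * k)\<close>; divide
      by \<open>r\<close> and let it tend to 0.\<close>
    define c where "c = s - t + (b - a) \<bullet> K a"
    define k where "k = ((b - a) \<bullet> K (b - a)) / 2"
    have *: "0 \<le> c + r * k" if r: "0 < r" "r \<le> 1" for r
    proof -
      have "(1 - r) *\<^sub>R (a, t) + r *\<^sub>R (b, s) \<in> E"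
        using E(2) aE bE r by (intro convexD) auto
      from \<mu>_le[OF this]
      have "\<mu> \<le> (1 - r) * t + r * s + ((a + r *\<^sub>R (b - a)) \<bullet> K (a + r *\<^sub>R (b - a))) / 2"
        by (simp add: \<Phi>_def algebra_simps)
      then have "0 \<le> r * (c + r * k)"
        unfolding quadratic_form_add[OF K(1,2)]
        by (simp add: t_def c_def k_def power2_eq_square field_simps)
      then show ?thesis using r by (simp add: zero_le_mult_iff)
    qed
    have "((\<lambda>r. c + r * k) \<longlongrightarrow> c + 0 * k) (at_right 0)"
      by (intro tendsto_intros)
    moreover have "\<forall>\<^sub>F r in at_right 0. 0 \<le> c + r * k"
      using * by (intro eventually_at_rightI[of 0 1]) auto
    ultimately have "0 \<le> c + 0 * k"
      by (intro tendsto_lowerbound) auto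
    then show ?thesis
      by (simp add: c_def inner_diff_left)
  qed
  with aE show ?thesis by auto
qed

section \<open>Representation of functionals and invertibility\<close>

text \<open>Riesz representation in the metric of \<open>K\<close>. Minimising over the epigraph of
  \<open>- f\<close> bounds the linear functional \<open>b \<bullet> K a - f b\<close> below, and
  such a functional vanishes.\<close>

lemma self_adjoint_representation:
  fixes K :: "'a::{real_inner, banach} \<Rightarrow> 'a" and f :: "'a \<Rightarrow> real"
  assumes K: "linear K" "self_adjoint K" "strongly_monotone K"
    and f: "bounded_linear f"
  shows "\<exists>a. \<forall>b. f b = b \<bullet> K a"
proof -
  interpret f: bounded_linear f by fact
  define E where "E = {(b, s). - f b \<le> s}"
  obtain \<beta> where \<beta>: "\<beta> > 0" "\<And>a. \<beta> * (norm a)\<^sup>2 \<le> a \<bullet> K a"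
    using K(3) by (auto simp: strongly_monotone_def)
  obtain C where C: "\<And>b. \<bar>f b\<bar> \<le> norm b * C"
    using f.bounded by (metis real_norm_def)
  have "\<exists>a t. (a, t) \<in> E \<and> (\<forall>(b, s)\<in>E. t + a \<bullet> K a \<le> s + b \<bullet> K a)"
  proof (rule quadratic_minimizer[OF K])
    have "E = {p. - f (fst p) \<le> snd p}" by (auto simp: E_def)
    then show "closed E"
      by (simp, intro closed_Collect_le continuous_intros f.continuous_on)
    show "convex E"
    proof (rule convexI)
      fix p q and u v :: real
      assume "p \<in> E" "q \<in> E" "0 \<le> u" "0 \<le> v"
      then have "u * (- f (fst p)) + v * (- f (fst q)) \<le> u * snd p + v * snd q"
        by (intro add_mono mult_left_mono) (auto simp: E_def)
      then show "u *\<^sub>R p + v *\<^sub>R q \<in> E"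
        by (simp add: E_def f.add f.scaleR case_prod_beta)
    qed
    have "(0, 0) \<in> E" by (simp add: E_def f.zero)
    then show "E \<noteq> {}" by blast
    fix a t assume "(a, t) \<in> E"
    then have "- (norm a * C) \<le> t"
      using C[of a] by (simp add: E_def)
    \<comment> \<open>Completing the square in \<open>norm a\<close> gives the lower bound.\<close>
    moreover have "0 \<le> (\<beta> * norm a - C)\<^sup>2 / (2 * \<beta>)" using \<beta> by simp
    then have "- (C\<^sup>2 / (2 * \<beta>)) \<le> - (norm a * C) + \<beta> * (norm a)\<^sup>2 / 2"
      using \<beta>(1) by (simp add: power2_eq_square field_simps)
    ultimately show "- (C\<^sup>2 / (2 * \<beta>)) \<le> t + (a \<bullet> K a) / 2"
      using \<beta>(2)[of a] by linarith
  qed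
  then obtain a t where "\<And>b. t + a \<bullet> K a \<le> - f b + b \<bullet> K a"
    by (fastforce simp: E_def)
  then have lower: "t + a \<bullet> K a \<le> b \<bullet> K a - f b" for b
    by (simp add: add.commute)
  have "f b = b \<bullet> K a" for b
  proof (rule ccontr)
    define g where "g = b \<bullet> K a - f b"
    assume "f b \<noteq> b \<bullet> K a"
    then have "g \<noteq> 0" by (simp add: g_def)
    have "t + a \<bullet> K a \<le> r * g" for r
      using lower[of "r *\<^sub>R b"] by (simp add: f.scaleR g_def algebra_simps)
    from this[of "(t + a \<bullet> K a - 1) / g"] \<open>g \<noteq> 0\<close> show False by simp
  qed
  then show ?thesis by blast
qed

lemma strongly_monotone_bij:
  fixes K :: "'a::{real_inner, banach} \<Rightarrow> 'a"
  assumes K: "linear K" "self_adjoint K" "strongly_monotone K"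
  shows "bij K"
proof (rule bijI)
  show "inj K"
  proof (rule injI)
    fix a b assume "K a = K b"
    then have "K (a - b) = 0" using K(1) by (simp add: linear_diff)
    then show "a = b" using strongly_monotone_eq_0[OF K(3), of "a - b"] by simp
  qed
  \<comment> \<open>Represent the functional \<open>b \<bullet> c\<close>, then test with
    \<open>b = c - K a\<close>.\<close>
  have "\<exists>a. c = K a" for c
  proof -
    obtain a where "\<And>b. b \<bullet> c = b \<bullet> K a"
      using self_adjoint_representation[OF K bounded_linear_inner_left[of c]] by blast
    then have "(c - K a) \<bullet> (c - K a) = 0"
      by (metis inner_diff_right right_minus_eq)
    then show ?thesis by auto
  qed
  then show "surj K" by (auto simp: surj_def)
qed

section \<open>Adjoints, conjugates and inverses\<close>

text \<open>\<open>adjoint\<close> is a choice operator, so its identity needs some adjoint to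
  exist; representation with the identity as \<open>K\<close> provides one.\<close>

lemma inner_adjoint_bounded_linear:
  fixes L :: "'a::{real_inner, banach} \<Rightarrow> 'b::real_inner"
  assumes "bounded_linear L"
  shows "L x \<bullet> y = x \<bullet> adjoint L y"
proof -
  have id: "linear (\<lambda>x::'a. x)" "self_adjoint (\<lambda>x::'a. x)" "strongly_monotone (\<lambda>x::'a. x)"
    by (auto simp: linear_iff self_adjoint_def strongly_monotone_def dot_square_norm intro!: exI[of _ 1])
  have "\<exists>a. \<forall>x. L x \<bullet> y = x \<bullet> a" for y
    using self_adjoint_representation[OF id bounded_linear_inner_left_comp[OF assms]] by blast
  then have "\<exists>f'. \<forall>x y. L x \<bullet> y = x \<bullet> f' y" by metis
  then show ?thesis
    unfolding adjoint_def by (rule someI2_ex) blast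
qed

lemma linear_adjoint_bounded_linear:
  fixes L :: "'a::{real_inner, banach} \<Rightarrow> 'b::real_inner"
  assumes "bounded_linear L"
  shows "linear (adjoint L)"
proof -
  note adj = inner_adjoint_bounded_linear[OF assms, symmetric]
  show ?thesis
    \<comment> \<open>Each equation reduces to its two sides having a difference orthogonal to
      itself.\<close>
    by (rule linearI; rule inner_eq_zero_iff[THEN iffD1, THEN eq_iff_diff_eq_0[THEN iffD2]])
      (simp_all add: inner_diff_right inner_add_right adj)
qed

text \<open>
  Surjectivity makes the vectors \<open>y\<close> with \<open>norm (adjoint L y) \<le> 1\<close> pointwise bounded, hence
  bounded; this replaces the open mapping theorem.
\<close>

lemma adjoint_bounded_below:
  fixes L :: "'a::{real_inner, banach} \<Rightarrow> 'b::{real_inner, banach}"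
  assumes L: "bounded_linear L" "range L = UNIV"
  shows "\<exists>C>0. \<forall>y. norm y \<le> C * norm (adjoint L y)"
proof -
  define U where "U = {y. norm (adjoint L y) \<le> 1}"
  note lin = linear_adjoint_bounded_linear[OF L(1)]
  have "\<exists>C. \<forall>u\<in>U. \<bar>u \<bullet> y\<bar> \<le> C" for y
  proof -
    obtain x where x: "y = L x" using L(2) by blast
    have "\<bar>u \<bullet> y\<bar> \<le> norm x" if "u \<in> U" for u
    proof -
      have "\<bar>u \<bullet> y\<bar> = \<bar>x \<bullet> adjoint L u\<bar>"
        using inner_adjoint_bounded_linear[OF L(1)] by (simp add: x inner_commute)
      also have "\<dots> \<le> norm x * norm (adjoint L u)" by (rule Cauchy_Schwarz_ineq2)
      also have "\<dots> \<le> norm x"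
        using that mult_left_mono[of "norm (adjoint L u)" 1 "norm x"] by (simp add: U_def)
      finally show ?thesis .
    qed
    then show ?thesis by blast
  qed
  from uniform_boundedness_inner[OF this] obtain C where C: "\<And>u. u \<in> U \<Longrightarrow> norm u \<le> C"
    by blast
  \<comment> \<open>The maximum makes the constant positive. Normalisation fails when
    \<open>adjoint L y = 0\<close>, but there surjectivity makes \<open>y\<close> orthogonal to
    itself.\<close>
  have "norm y \<le> max C 1 * norm (adjoint L y)" for y
  proof (cases "adjoint L y = 0")
    case True
    obtain x where "y = L x" using L(2) by blast
    then have "y \<bullet> y = x \<bullet> adjoint L y"
      using inner_adjoint_bounded_linear[OF L(1)] by metis
    then show ?thesis using True by simp
  next
    case False
    have "(1 / norm (adjoint L y)) *\<^sub>R y \<in> U"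
      using False by (simp add: U_def linear_scale[OF lin])
    from C[OF this] have "norm y \<le> C * norm (adjoint L y)"
      using False by (simp add: field_simps)
    also have "\<dots> \<le> max C 1 * norm (adjoint L y)" by (intro mult_right_mono) auto
    finally show ?thesis .
  qed
  moreover have "max C 1 > 0" by simp
  ultimately show ?thesis by blast
qed

text \<open>The quadratic form of the conjugate at \<open>y\<close> is that of \<open>K\<close> at
  \<open>adjoint L y\<close>, whose norm controls \<open>norm y\<close> when \<open>L\<close> is
  onto.\<close>

lemma
  fixes L :: "'a::{real_inner, banach} \<Rightarrow> 'b::{real_inner, banach}"
  assumes L: "bounded_linear L"
    and K: "linear K" "self_adjoint K" "strongly_monotone K"
  shows linear_conjugate: "linear (L \<circ> K \<circ> adjoint L)"
    and self_adjoint_conjugate: "self_adjoint (L \<circ> K \<circ> adjoint L)"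
    and strongly_monotone_conjugate:
      "range L = UNIV \<Longrightarrow> strongly_monotone (L \<circ> K \<circ> adjoint L)"
proof -
  note adj = inner_adjoint_bounded_linear[OF L]
  show "linear (L \<circ> K \<circ> adjoint L)"
    by (intro linear_compose linear_adjoint_bounded_linear bounded_linear.linear L K)
  show "self_adjoint (L \<circ> K \<circ> adjoint L)"
    using K(2) adj by (simp add: self_adjoint_def) (metis inner_commute)
  show "strongly_monotone (L \<circ> K \<circ> adjoint L)" if surj: "range L = UNIV"
  proof -
    obtain C where C: "C > 0" "\<And>y. norm y \<le> C * norm (adjoint L y)"
      using adjoint_bounded_below[OF L surj] by blast
    obtain \<beta> where \<beta>: "\<beta> > 0" "\<And>a. \<beta> * (norm a)\<^sup>2 \<le> a \<bullet> K a"
      using K(3) by (auto simp: strongly_monotone_def)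
    have "\<beta> / C\<^sup>2 * (norm y)\<^sup>2 \<le> y \<bullet> L (K (adjoint L y))" for y
    proof -
      have "(norm y)\<^sup>2 \<le> C\<^sup>2 * (norm (adjoint L y))\<^sup>2"
        using power_mono[OF C(2), of y 2] by (simp add: power_mult_distrib)
      then have "\<beta> / C\<^sup>2 * (norm y)\<^sup>2 \<le> \<beta> / C\<^sup>2 * (C\<^sup>2 * (norm (adjoint L y))\<^sup>2)"
        using \<beta> C by (intro mult_left_mono) auto
      also have "\<dots> = \<beta> * (norm (adjoint L y))\<^sup>2" using C by simp
      also have "\<dots> \<le> adjoint L y \<bullet> K (adjoint L y)" by (rule \<beta>)
      also have "\<dots> = y \<bullet> L (K (adjoint L y))" using adj by (metis inner_commute)
      finally show ?thesis .
    qed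
    moreover have "\<beta> / C\<^sup>2 > 0" using \<beta> C by simp
    ultimately show ?thesis by (auto simp: strongly_monotone_def)
  qed
qed

text \<open>The form of \<open>inv K\<close> at \<open>y\<close> is that of \<open>K\<close> at
  \<open>inv K y\<close>; continuity of \<open>K\<close> bounds \<open>norm (inv K y)\<close> below
  by \<open>norm y / M\<close>.\<close>

lemma
  fixes K :: "'a::{real_inner, banach} \<Rightarrow> 'a"
  assumes K: "linear K" "self_adjoint K" "strongly_monotone K"
  shows linear_inv: "linear (inv K)"
    and self_adjoint_inv: "self_adjoint (inv K)"
    and strongly_monotone_inv: "strongly_monotone (inv K)"
proof -
  have K_inv: "K (inv K y) = y" for y
    using strongly_monotone_bij[OF K] by (simp add: bij_is_surj surj_f_inv_f)
  have inv_K: "inv K (K y) = y" for y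
    using strongly_monotone_bij[OF K] by (simp add: bij_is_inj)
  show "linear (inv K)"
  proof (rule linearI)
    fix a b :: 'a and r :: real
    have "K (inv K a + inv K b) = a + b" "K (r *\<^sub>R inv K a) = r *\<^sub>R a"
      by (simp_all add: linear_add[OF K(1)] linear_scale[OF K(1)] K_inv)
    then show "inv K (a + b) = inv K a + inv K b" "inv K (r *\<^sub>R a) = r *\<^sub>R inv K a"
      by (metis inv_K)+
  qed
  show "self_adjoint (inv K)"
    using K(2) unfolding self_adjoint_def by (metis K_inv)
  obtain M where M: "M > 0" "\<And>a. norm (K a) \<le> norm a * M"
    using bounded_linear.pos_bounded[OF Hellinger_Toeplitz[OF K(1,2)]] by blast
  obtain \<beta> where \<beta>: "\<beta> > 0" "\<And>a. \<beta> * (norm a)\<^sup>2 \<le> a \<bullet> K a"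
    using K(3) by (auto simp: strongly_monotone_def)
  have "\<beta> / M\<^sup>2 * (norm y)\<^sup>2 \<le> y \<bullet> inv K y" for y
  proof -
    have "(norm y)\<^sup>2 \<le> M\<^sup>2 * (norm (inv K y))\<^sup>2"
      using power_mono[OF M(2), of "inv K y" 2]
      by (simp add: power_mult_distrib K_inv mult.commute)
    then have "\<beta> / M\<^sup>2 * (norm y)\<^sup>2 \<le> \<beta> / M\<^sup>2 * (M\<^sup>2 * (norm (inv K y))\<^sup>2)"
      using \<beta> M by (intro mult_left_mono) auto
    also have "\<dots> = \<beta> * (norm (inv K y))\<^sup>2" using M by simp
    also have "\<dots> \<le> inv K y \<bullet> K (inv K y)" by (rule \<beta>)
    finally show ?thesis by (simp add: K_inv inner_commute)
  qed
  moreover have "\<beta> / M\<^sup>2 > 0" using \<beta> M by simp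
  ultimately show "strongly_monotone (inv K)" by (auto simp: strongly_monotone_def)
qed

section \<open>Resolvents of monotone operators\<close>

text \<open>Adjoining \<open>(x, u)\<close> to the graph keeps it monotone, so by maximality the
  pair was already there.\<close>

lemma maximally_monotoneD:
  assumes "maximally_monotone B"
    and rel: "\<And>y v. v \<in> B y \<Longrightarrow> 0 \<le> (x - y) \<bullet> (u - v)"
  shows "u \<in> B x"
proof -
  have mono: "monotone_operator B"
    and max: "\<And>N. monotone_operator N \<Longrightarrow> B \<le> N \<Longrightarrow> N = B"
    using assms(1) by (auto simp: maximally_monotone_def)
  define N where "N = (\<lambda>y. B y \<union> {w. y = x \<and> w = u})"
  have rel': "0 \<le> (y - x) \<bullet> (v - u)" if "v \<in> B y" for y v
    using rel[OF that] by (simp add: inner_diff_left inner_diff_right algebra_simps)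
  have "monotone_operator N"
    unfolding monotone_operator_def N_def
    using mono rel rel' by (auto simp: monotone_operator_def)
  moreover have "B \<le> N" by (auto simp: N_def le_fun_def)
  ultimately have "N = B" by (rule max)
  moreover have "u \<in> N x" by (simp add: N_def)
  ultimately show ?thesis by simp
qed

text \<open>Reduces the resolvent equation at an arbitrary point to
  \<open>minty_zero\<close>.\<close>

lemma maximally_monotone_translate:
  assumes "maximally_monotone B"
  shows "maximally_monotone (\<lambda>x. {v. v + c \<in> B x})"
  unfolding maximally_monotone_def
proof (intro conjI allI impI)
  show "monotone_operator (\<lambda>x. {v. v + c \<in> B x})"
    using assms unfolding maximally_monotone_def monotone_operator_def
    by (metis (no_types, lifting) add_diff_cancel_right mem_Collect_eq)
next
  fix N
  assume N: "monotone_operator N" "(\<lambda>x. {v. v + c \<in> B x}) \<le> N"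
  have "v + c \<in> B x" if "v \<in> N x" for v x
  proof (rule maximally_monotoneD[OF assms])
    fix y w assume "w \<in> B y"
    then have "w - c \<in> N y"
      using le_funD[OF N(2), of y] by (auto intro: subsetD)
    then have "0 \<le> (x - y) \<bullet> (v - (w - c))"
      using N(1) that by (auto simp: monotone_operator_def)
    then show "0 \<le> (x - y) \<bullet> (v + c - w)" by (simp add: algebra_simps)
  qed
  then show "N = (\<lambda>x. {v. v + c \<in> B x})"
    using N(2) by (intro ext) (auto simp: le_fun_def)
qed

text \<open>
  Minty's theorem for the inner product induced by \<open>T\<close>. The set \<open>E\<close> is the epigraph of the
  Fitzpatrick function of \<open>B\<close>; by maximality that function dominates the duality pairing, which
  bounds the objective \<open>t + 1/2 (x \<bullet> T x + u \<bullet> inv T u)\<close> below by zero. The first-order condition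
  at the minimiser \<open>(x, u)\<close> says that \<open>(- inv T u, - T x)\<close> is monotonically related to the graph of
  \<open>B\<close>, and testing it against that very point forces \<open>x = - inv T u\<close>.
\<close>

lemma minty_zero:
  fixes B :: "'a::{real_inner, banach} \<Rightarrow> 'a set"
  assumes B: "maximally_monotone B"
    and T: "linear T" "self_adjoint T" "strongly_monotone T"
  shows "\<exists>x. - T x \<in> B x"
proof -
  define S where "S = inv T"
  have S: "linear S" "self_adjoint S" "strongly_monotone S"
    unfolding S_def by (intro linear_inv self_adjoint_inv strongly_monotone_inv T)+
  have TS: "T (S u) = u" for u
    using strongly_monotone_bij[OF T] by (simp add: S_def bij_is_surj surj_f_inv_f)
  have mono: "0 \<le> (x - y) \<bullet> (u - v)" if "u \<in> B x" "v \<in> B y" for x y u v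
    using B that by (auto simp: maximally_monotone_def monotone_operator_def)
  \<comment> \<open>Block-diagonal on the product space, so that one minimisation treats the primal
    and dual variables together.\<close>
  define K where "K p = (T (fst p), S (snd p))" for p
  define E where "E = {((x, u), t). \<forall>y. \<forall>v\<in>B y. x \<bullet> v + y \<bullet> u - y \<bullet> v \<le> t}"
  have K: "linear K" "self_adjoint K" "strongly_monotone K"
  proof -
    show "linear K"
      using T(1) S(1) by (auto intro!: linearI simp: K_def linear_add linear_scale)
    show "self_adjoint K"
      using T(2) S(2) by (auto simp: K_def self_adjoint_def inner_prod_def)
    obtain \<beta> \<gamma> where \<beta>: "\<beta> > 0" "\<And>a. \<beta> * (norm a)\<^sup>2 \<le> a \<bullet> T a"
      and \<gamma>: "\<gamma> > 0" "\<And>a. \<gamma> * (norm a)\<^sup>2 \<le> a \<bullet> S a"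
      using T(3) S(3) by (auto simp: strongly_monotone_def)
    have "min \<beta> \<gamma> * (norm p)\<^sup>2 \<le> p \<bullet> K p" for p
    proof -
      have "min \<beta> \<gamma> * (norm p)\<^sup>2 = min \<beta> \<gamma> * (norm (fst p))\<^sup>2 + min \<beta> \<gamma> * (norm (snd p))\<^sup>2"
        by (simp add: norm_prod_def algebra_simps)
      also have "\<dots> \<le> \<beta> * (norm (fst p))\<^sup>2 + \<gamma> * (norm (snd p))\<^sup>2"
        by (intro add_mono mult_right_mono) auto
      also have "\<dots> \<le> p \<bullet> K p"
        using \<beta>(2)[of "fst p"] \<gamma>(2)[of "snd p"] by (simp add: K_def inner_prod_def)
      finally show ?thesis .
    qed
    then show "strongly_monotone K"
      using \<beta>(1) \<gamma>(1) by (auto simp: strongly_monotone_def intro!: exI[of _ "min \<beta> \<gamma>"])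
  qed
  \<comment> \<open>If \<open>t < x \<bullet> u\<close>, membership in \<open>E\<close> makes
    \<open>(x, u)\<close> monotonically related to the graph, hence a point of it; the inequality of
    \<open>E\<close> at that point is the contradiction.\<close>
  have pairing_le: "x \<bullet> u \<le> t" if "((x, u), t) \<in> E" for x u t
  proof (rule ccontr)
    assume "\<not> x \<bullet> u \<le> t"
    moreover have E: "x \<bullet> v + y \<bullet> u - y \<bullet> v \<le> t" if "v \<in> B y" for y v
      using \<open>((x, u), t) \<in> E\<close> that by (auto simp: E_def)
    ultimately have "0 \<le> (x - y) \<bullet> (u - v)" if "v \<in> B y" for y v
      using E[OF that] by (simp add: inner_diff_left inner_diff_right)
    then have "u \<in> B x" by (rule maximally_monotoneD[OF B])
    from E[OF this] \<open>\<not> x \<bullet> u \<le> t\<close> show False by simp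
  qed
  have square: "x \<bullet> T x + 2 * (x \<bullet> u) + u \<bullet> S u = (x + S u) \<bullet> T (x + S u)" for x u
  proof -
    have "S u \<bullet> T x = x \<bullet> u"
      using T(2) TS by (metis inner_commute self_adjoint_def)
    then show ?thesis
      by (simp add: linear_add[OF T(1)] TS inner_add_left inner_add_right inner_commute)
  qed
  have graphE: "((y, v), y \<bullet> v) \<in> E" if "v \<in> B y" for y v
    using mono[OF that] by (fastforce simp: E_def inner_diff_left inner_diff_right inner_commute)
  have "\<exists>a t. (a, t) \<in> E \<and> (\<forall>(b, s)\<in>E. t + a \<bullet> K a \<le> s + b \<bullet> K a)"
  proof (rule quadratic_minimizer[OF K])
    have E_eq: "E = (\<Inter>y. \<Inter>v\<in>B y. {p. fst (fst p) \<bullet> v + y \<bullet> snd (fst p) - y \<bullet> v \<le> snd p})"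
      by (auto simp: E_def)
    show "closed E"
      unfolding E_eq by (intro closed_INT ballI closed_Collect_le continuous_intros)
    show "convex E"
      unfolding E_eq
    proof (intro convex_INT)
      fix y v
      show "convex {p. fst (fst p) \<bullet> v + y \<bullet> snd (fst p) - y \<bullet> v \<le> snd p}"
      proof (rule convexI, clarsimp simp: inner_add_left inner_add_right)
        fix x1 u1 x2 u2 t1 t2 and a b :: real
        assume *: "x1 \<bullet> v + y \<bullet> u1 - y \<bullet> v \<le> t1" "x2 \<bullet> v + y \<bullet> u2 - y \<bullet> v \<le> t2"
          and ab: "0 \<le> a" "0 \<le> b" "a + b = 1"
        have "a * (x1 \<bullet> v + y \<bullet> u1 - y \<bullet> v) + b * (x2 \<bullet> v + y \<bullet> u2 - y \<bullet> v) \<le> a * t1 + b * t2"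
          using * ab by (intro add_mono mult_left_mono)
        moreover have "a * (y \<bullet> v) + b * (y \<bullet> v) = y \<bullet> v"
          using ab(3) by (metis distrib_right mult_1)
        ultimately show "a * (x1 \<bullet> v) + b * (x2 \<bullet> v) + (a * (y \<bullet> u1) + b * (y \<bullet> u2)) - y \<bullet> v
            \<le> a * t1 + b * t2"
          by (simp add: algebra_simps)
      qed
    qed
    \<comment> \<open>With an empty graph, \<open>(0, 0)\<close> would be vacuously related to it,
      hence in it.\<close>
    have "\<exists>y v. v \<in> B y"
      using maximally_monotoneD[OF B, of 0 0] by blast
    then show "E \<noteq> {}" using graphE by blast
    fix a t assume at: "(a, t) \<in> E"
    obtain x u where a: "a = (x, u)" by fastforce
    have "a \<bullet> K a = (x + S u) \<bullet> T (x + S u) - 2 * (x \<bullet> u)"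
      using square[of x u] by (simp add: a K_def inner_prod_def)
    moreover have "0 \<le> (x + S u) \<bullet> T (x + S u)"
      by (rule strongly_monotone_nonneg[OF T(3)])
    moreover have "x \<bullet> u \<le> t"
      using pairing_le at by (simp add: a)
    ultimately show "0 \<le> t + (a \<bullet> K a) / 2"
      by linarith
  qed
  then obtain x u t where xut: "((x, u), t) \<in> E"
    and opt: "\<And>b s. (b, s) \<in> E \<Longrightarrow> t + (x, u) \<bullet> K (x, u) \<le> s + b \<bullet> K (x, u)"
    by fastforce
  have related: "(x + S u) \<bullet> T (x + S u) \<le> (- S u - y) \<bullet> (- T x - v)" if "v \<in> B y" for y v
  proof -
    have "t + x \<bullet> T x + u \<bullet> S u \<le> y \<bullet> v + y \<bullet> T x + v \<bullet> S u"
      using opt[OF graphE[OF that]] by (simp add: K_def inner_prod_def)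
    moreover have "x \<bullet> u \<le> t" by (rule pairing_le[OF xut])
    moreover have "S u \<bullet> T x = x \<bullet> u"
      using T(2) TS by (metis inner_commute self_adjoint_def)
    ultimately show ?thesis
      using square[of x u]
      by (simp add: inner_diff_left inner_diff_right inner_commute algebra_simps)
  qed
  have graph: "- T x \<in> B (- S u)"
  proof (rule maximally_monotoneD[OF B])
    fix y v assume "v \<in> B y"
    from related[OF this] show "0 \<le> (- S u - y) \<bullet> (- T x - v)"
      using strongly_monotone_nonneg[OF T(3), of "x + S u"] by linarith
  qed
  \<comment> \<open>At \<open>y = - S u\<close>, \<open>v = - T x\<close> the right-hand side is
    zero.\<close>
  from related[OF this] have "x + S u = 0"
    by (intro strongly_monotone_eq_0[OF T(3)]) simp
  then have "- S u = x"
    by (metis minus_unique add.commute)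
  with graph show ?thesis by auto
qed

section \<open>Resolvents as point-valued maps\<close>

lemma resolvent_iff: "p \<in> resolvent M w \<longleftrightarrow> w - p \<in> M p"
  by (auto simp: resolvent_def op_inverse_def intro!: image_eqI[of _ _ "w - p"])

lemma J_eqI:
  assumes "p \<in> resolvent M w" and "\<And>q. q \<in> resolvent M w \<Longrightarrow> q = p"
  shows "J M w = p"
proof -
  have "resolvent M w = {p}" using assms by blast
  then show ?thesis by (simp add: J_def)
qed

text \<open>Monotonicity makes the form of \<open>K\<close> at \<open>R (b - c)\<close> nonpositive.
  Identities for \<open>L\<close> and \<open>R\<close> give the case \<open>S B\<close>, the adjoint
  for \<open>R\<close> the case \<open>\<Upsilon> L\<^sup>* B L\<close>; each use supplies its own
  existence witness.\<close>

lemma resolvent_congruence_unique: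
  assumes B: "monotone_operator B"
    and K: "linear K" "strongly_monotone K"
    and L: "linear L" "linear R" "\<And>x y. L x \<bullet> y = x \<bullet> R y"
    and "p \<in> resolvent (\<lambda>y. K ` R ` B (L y)) w" "q \<in> resolvent (\<lambda>y. K ` R ` B (L y)) w"
  shows "q = p"
proof -
  obtain b c where b: "b \<in> B (L p)" "w - p = K (R b)" and c: "c \<in> B (L q)" "w - q = K (R c)"
    using assms(7,8) by (auto simp: resolvent_iff)
  have d: "q - p = K (R (b - c))"
    using b(2) c(2) by (simp add: linear_diff[OF L(2)] linear_diff[OF K(1)] algebra_simps)
  have "0 \<le> (L p - L q) \<bullet> (b - c)"
    using B b(1) c(1) by (auto simp: monotone_operator_def)
  also have "\<dots> = (p - q) \<bullet> R (b - c)"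
    by (simp add: L(3) flip: linear_diff[OF L(1)])
  also have "\<dots> = - (R (b - c) \<bullet> K (R (b - c)))"
    by (metis d inner_commute inner_minus_left minus_diff_eq)
  finally have "R (b - c) = 0"
    by (intro strongly_monotone_eq_0[OF K(2)]) simp
  then show ?thesis using d by (simp add: linear_0[OF K(1)])
qed

text \<open>Minty's theorem with \<open>T = inv S\<close>, for \<open>B\<close> translated by
  \<open>inv S w\<close>, yields the point \<open>p\<close> with
  \<open>inv S (w - p) \<in> B p\<close>.\<close>

lemma J_scaled:
  fixes B :: "'a::{real_inner, banach} \<Rightarrow> 'a set"
  assumes B: "maximally_monotone B"
    and S: "linear S" "self_adjoint S" "strongly_monotone S"
  shows "inv S (w - J (\<lambda>y. S ` B y) w) \<in> B (J (\<lambda>y. S ` B y) w)"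
proof -
  note T = linear_inv[OF S] self_adjoint_inv[OF S] strongly_monotone_inv[OF S]
  have S_inv: "S (inv S y) = y" for y
    using strongly_monotone_bij[OF S] by (simp add: bij_is_surj surj_f_inv_f)
  obtain p where "- inv S p \<in> {v. v + inv S w \<in> B p}"
    using minty_zero[OF maximally_monotone_translate[OF B] T] by blast
  then have p: "inv S (w - p) \<in> B p"
    by (simp add: linear_diff[OF T(1)])
  have "J (\<lambda>y. S ` B y) w = p"
  proof (rule J_eqI)
    show res: "p \<in> resolvent (\<lambda>y. S ` B y) w"
      using p S_inv by (metis (no_types) imageI resolvent_iff)
    fix q assume "q \<in> resolvent (\<lambda>y. S ` B y) w"
    then show "q = p"
      using resolvent_congruence_unique[of B S "\<lambda>y. y" "\<lambda>y. y" p w q] B S res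
      by (simp add: maximally_monotone_def linear_iff)
  qed
  with p show ?thesis by simp
qed

section \<open>The recurrence for \<open>z\<close>\<close>

theorem proposition3p5:
  fixes A :: "'h::{real_inner, banach} \<Rightarrow> 'h set"
    and B :: "'g::{real_inner, banach} \<Rightarrow> 'g set"
    and L :: "'h \<Rightarrow> 'g"
    and \<Upsilon> :: "'h \<Rightarrow> 'h"
    and \<Sigma> :: "'g \<Rightarrow> 'g"
    and x z :: "nat \<Rightarrow> 'h"
    and u v :: "nat \<Rightarrow> 'g"
  assumes "maximally_monotone A"
    and "maximally_monotone B"
    and "bounded_linear L"
    and "L \<noteq> (\<lambda>_. 0)"
    and "primal_dual_solutions A B L \<noteq> {}"
    and "range L = UNIV"
    and "linear \<Upsilon>"
    and "self_adjoint \<Upsilon>"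
    and "strongly_monotone \<Upsilon>"
    and "\<Sigma> = inv (L \<circ> \<Upsilon> \<circ> adjoint L)"
    and "\<And>n. v n = (\<lambda>w. \<Sigma> (w - J (\<lambda>y. inv \<Sigma> ` B y) w)) (L (x n) + inv \<Sigma> (u n))"
    and "\<And>n. z n = x n - \<Upsilon> (adjoint L (v n))"
    and "\<And>n. x (Suc n) = J (\<lambda>y. \<Upsilon> ` A y) (z n)"
    and "\<And>n. u (Suc n) = \<Sigma> (L (x (Suc n) - x n)) + v n"
  shows "z 0 = x 0 - \<Upsilon> (adjoint L
           ((\<lambda>w. \<Sigma> (w - J (\<lambda>y. inv \<Sigma> ` B y) w)) (L (x 0) + inv \<Sigma> (u 0))))
    \<and> (\<forall>n. z (Suc n) =
          J (\<lambda>y. \<Upsilon> ` adjoint L ` B (L y)) (2 *\<^sub>R J (\<lambda>y. \<Upsilon> ` A y) (z n) - z n)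
          + z n - J (\<lambda>y. \<Upsilon> ` A y) (z n))"
proof -
  note B = assms(2) and L = assms(3) and \<Upsilon> = assms(7-9)
    and v = assms(11) and z = assms(12) and x = assms(13) and u = assms(14)
  note linL = bounded_linear.linear[OF L] and adj = inner_adjoint_bounded_linear[OF L]
  define S where "S = L \<circ> \<Upsilon> \<circ> adjoint L"
  have S: "linear S" "self_adjoint S" "strongly_monotone S"
    unfolding S_def using assms(6)
    by (auto intro: linear_conjugate self_adjoint_conjugate strongly_monotone_conjugate L \<Upsilon>)
  have \<Sigma>: "\<Sigma> = inv S" "inv \<Sigma> = S"
    using assms(10) strongly_monotone_bij[OF S] by (auto simp: S_def inv_inv_eq)
  have S\<Sigma>: "S (\<Sigma> y) = y" for y
    using strongly_monotone_bij[OF S] by (simp add: \<Sigma> bij_is_surj surj_f_inv_f)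
  have v_in: "v n \<in> B (L (x n) + S (u n) - S (v n))" for n
  proof -
    define w where "w = L (x n) + S (u n)"
    have "v n = \<Sigma> (w - J (\<lambda>y. S ` B y) w)"
      by (simp add: v \<Sigma>(2) w_def)
    \<comment> \<open>Applying \<open>S\<close> to the formula for \<open>v n\<close> recovers the
      resolvent.\<close>
    moreover from this have "J (\<lambda>y. S ` B y) w = w - S (v n)"
      by (simp add: S\<Sigma>)
    ultimately show ?thesis
      using J_scaled[OF B S, of w] by (simp add: \<Sigma>(1) w_def)
  qed
  have "z (Suc n) = J (\<lambda>y. \<Upsilon> ` adjoint L ` B (L y)) (2 *\<^sub>R x (Suc n) - z n) + z n - x (Suc n)"
    for n
  proof -
    define q where "q = 2 *\<^sub>R x (Suc n) - z n - \<Upsilon> (adjoint L (v (Suc n)))"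
    have "L q = L (x (Suc n)) + S (u (Suc n)) - S (v (Suc n))"
    proof -
      \<comment> \<open>Both \<open>z n\<close> and \<open>u (Suc n)\<close> carry the old dual
        value \<open>v n\<close>, so \<open>L (x n)\<close> and \<open>S (v n)\<close> enter the two
        sides alike.\<close>
      have "L (\<Upsilon> (adjoint L y)) = S y" for y by (simp add: S_def)
      then have "L q = 2 *\<^sub>R L (x (Suc n)) - (L (x n) - S (v n)) - S (v (Suc n))"
        by (simp add: q_def z[of n] linear_diff[OF linL] linear_scale[OF linL])
      moreover have "S (u (Suc n)) = L (x (Suc n)) - L (x n) + S (v n)"
        by (simp add: u[of n] S\<Sigma> linear_add[OF S(1)] linear_diff[OF linL])
      ultimately show ?thesis by (simp add: scaleR_2)
    qed
    then have vq: "v (Suc n) \<in> B (L q)"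
      using v_in[of "Suc n"] by simp
    have "J (\<lambda>y. \<Upsilon> ` adjoint L ` B (L y)) (2 *\<^sub>R x (Suc n) - z n) = q"
    proof (rule J_eqI)
      show res: "q \<in> resolvent (\<lambda>y. \<Upsilon> ` adjoint L ` B (L y)) (2 *\<^sub>R x (Suc n) - z n)"
        using vq by (auto simp: resolvent_iff q_def)
      show "q' = q" if "q' \<in> resolvent (\<lambda>y. \<Upsilon> ` adjoint L ` B (L y)) (2 *\<^sub>R x (Suc n) - z n)" for q'
        using B by (intro resolvent_congruence_unique[OF _ \<Upsilon>(1,3) linL
              linear_adjoint_bounded_linear[OF L] adj res that])
          (simp add: maximally_monotone_def)
    qed
    \<comment> \<open>\<open>q + z n - x (Suc n)\<close> is the definition of
      \<open>z (Suc n)\<close>.\<close>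
    then show ?thesis
      by (simp add: q_def z[of "Suc n"] scaleR_2)
  qed
  then show ?thesis
    using z[of 0] v[of 0] x by simp
qed

end
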